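(* Let $X$ be a compact metric space, let $f:X\to X$ be a continuous function, let $A$ be a nowhere dense closed subset of $X$ such that $f(A)\subseteq A$ and $f(X\setminus A)\subseteq X\setminus A$, and let $\sim$ be the equivalence relation on $X$ defined by $$x\sim y \iff x=y \text{ or } x,y\in A \qquad (x,y\in X).$$ Let $f^{\star}:X/_{\sim}\to X/_{\sim}$ be given by $f^{\star}([x])=[f(x)]$. Then the following statements are equivalent. 1. The set $\mathcal P(f)$ of periodic points in $(X,f)$ is dense in $X$. 2. The set $\mathcal P(f^{\star})$ of periodic points in $(X/_{\sim},f^{\star})$ is dense in $X/_{\sim}$.
   Context: $[x]$ denotes the equivalence class of $x$, and $X/_{\sim}$ is the set of equivalence classes with the quotient topology. The map $f^{\star}$ is well defined since $f(A)\subseteq A$. A point $p$ is periodic in $(Y,g)$ if $g^n(p)=p$ for some positive integer $n$; $\mathcal P(g)$ is the set of periodic points in $(Y,g)$. *)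

theory Defs
  imports "HOL-Analysis.Analysis"
begin

definition dense_in :: "'a topology \<Rightarrow> 'a set \<Rightarrow> bool" where
  "dense_in T S \<longleftrightarrow> S \<subseteq> topspace T \<and> T closure_of S = topspace T"

definition nowhere_dense_in :: "'a topology \<Rightarrow> 'a set \<Rightarrow> bool" where
  "nowhere_dense_in T S \<longleftrightarrow> S \<subseteq> topspace T \<and> T interior_of (T closure_of S) = {}"

definition periodic_points :: "'a set \<Rightarrow> ('a \<Rightarrow> 'a) \<Rightarrow> 'a set" where
  "periodic_points Y g = {p \<in> Y. \<exists>n>0. (g ^^ n) p = p}"

definition collapse_rel :: "'a set \<Rightarrow> 'a set \<Rightarrow> ('a \<times> 'a) set" where
  "collapse_rel X A = {(x, y). x \<in> X \<and> y \<in> X \<and> (x = y \<or> x \<in> A \<and> y \<in> A)}"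

lemma equiv_collapse_rel: "equiv X (collapse_rel X A)"
  by (auto simp: equiv_def refl_on_def sym_def trans_def collapse_rel_def)

definition quotient_topology :: "'a topology \<Rightarrow> ('a \<times> 'a) set \<Rightarrow> 'a set topology" where
  "quotient_topology T r = topology (\<lambda>U. U \<subseteq> topspace T // r \<and>
     openin T {x \<in> topspace T. r `` {x} \<in> U})"

lemma openin_quotient_topology:
  "openin (quotient_topology T r) U \<longleftrightarrow>
     U \<subseteq> topspace T // r \<and> openin T {x \<in> topspace T. r `` {x} \<in> U}"
proof -
  have "istopology (\<lambda>U. U \<subseteq> topspace T // r \<and> openin T {x \<in> topspace T. r `` {x} \<in> U})"
    unfolding istopology_def
  proof (intro conjI allI impI; (elim conjE)?)
    fix U V
    assume "openin T {x \<in> topspace T. r `` {x} \<in> U}" "openin T {x \<in> topspace T. r `` {x} \<in> V}"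
    moreover have "{x \<in> topspace T. r `` {x} \<in> U \<inter> V} =
        {x \<in> topspace T. r `` {x} \<in> U} \<inter> {x \<in> topspace T. r `` {x} \<in> V}" by blast
    ultimately show "openin T {x \<in> topspace T. r `` {x} \<in> U \<inter> V}"
      by (simp only: openin_Int)
  next
    fix K
    assume K: "\<forall>U\<in>K. U \<subseteq> topspace T // r \<and> openin T {x \<in> topspace T. r `` {x} \<in> U}"
    have "{x \<in> topspace T. r `` {x} \<in> \<Union>K} = (\<Union>U\<in>K. {x \<in> topspace T. r `` {x} \<in> U})" by blast
    then show "openin T {x \<in> topspace T. r `` {x} \<in> \<Union>K}" using K by auto
    show "\<Union>K \<subseteq> topspace T // r" using K by blast
  qed auto
  then show ?thesis by (simp add: quotient_topology_def)
qed

lemma topspace_quotient_topology: "topspace (quotient_topology T r) = topspace T // r"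
proof
  have "{x \<in> topspace T. r `` {x} \<in> topspace T // r} = topspace T"
    by (auto intro: quotientI)
  then have "openin (quotient_topology T r) (topspace T // r)"
    by (simp add: openin_quotient_topology)
  then show "topspace T // r \<subseteq> topspace (quotient_topology T r)" by (rule openin_subset)
  show "topspace (quotient_topology T r) \<subseteq> topspace T // r"
    using openin_quotient_topology openin_topspace by blast
qed

lemma quotient_map_quotient_topology:
  "quotient_map T (quotient_topology T r) (\<lambda>x. r `` {x})"
  by (auto simp: quotient_map_def topspace_quotient_topology openin_quotient_topology quotient_def)

(* The union ranges over equal sets whenever f respects r, and is then the class of f x
   for any representative x of C. *)
definition quotient_fun :: "('a \<times> 'a) set \<Rightarrow> ('a \<Rightarrow> 'a) \<Rightarrow> 'a set \<Rightarrow> 'a set" where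
  "quotient_fun r f C = (\<Union>x\<in>C. r `` {f x})"

lemma quotient_fun_class:
  assumes "f \<in> X \<rightarrow> X" "f ` A \<subseteq> A" "x \<in> X"
  shows "quotient_fun (collapse_rel X A) f (collapse_rel X A `` {x}) = collapse_rel X A `` {f x}"
  proof -
  have "congruent (collapse_rel X A) (\<lambda>y. collapse_rel X A `` {f y})"
    using assms(1,2) by (auto simp: congruent_def collapse_rel_def)
  then show ?thesis
    unfolding quotient_fun_def by (rule UN_equiv_class[OF equiv_collapse_rel _ assms(3)])
qed

end

theory Submission
  imports Defs
begin

text \<open>
  Let \<open>q\<close> be the projection of \<open>X\<close> onto the quotient. It is a semiconjugacy,
  \<open>q (f x) = f\<^sup>\<star> (q x)\<close>, so it carries periodic points to periodic points; being
  continuous and surjective, it carries dense sets to dense sets. This gives one direction.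

  For the other one, \<open>q\<close> is injective off \<open>A\<close>: the class of a point outside \<open>A\<close> is a
  singleton. Hence a point outside \<open>A\<close> whose class is periodic is itself periodic, with the same
  period (\<open>class_periodic_iff\<close>). Let \<open>U\<close> be open and nonempty. Since \<open>A\<close> is closed and nowhere
  dense, \<open>U - A\<close> is again open and nonempty, and as a saturated set it has an open image under
  \<open>q\<close> (\<open>openin_classes_off_collapsed\<close>). Density in the quotient puts a periodic class into this
  image, and its single element is a periodic point of \<open>f\<close> in \<open>U\<close>.
\<close>

lemma dense_in_iff_meets_open:
  "dense_in T S \<longleftrightarrow> S \<subseteq> topspace T \<and> (\<forall>U. openin T U \<and> U \<noteq> {} \<longrightarrow> S \<inter> U \<noteq> {})"
  by (auto simp: dense_in_def dense_intersects_open)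

lemma funpow_in_carrier:
  assumes "f \<in> X \<rightarrow> X" "x \<in> X"
  shows "(f ^^ n) x \<in> X"
  using assms by (induction n) auto

lemma class_eq_iff:
  assumes "x \<in> X" "y \<in> X"
  shows "collapse_rel X A `` {x} = collapse_rel X A `` {y} \<longleftrightarrow> x = y \<or> x \<in> A \<and> y \<in> A"
  using assms by (auto simp: collapse_rel_def)

lemma quotient_fun_funpow_class:
  assumes "f \<in> X \<rightarrow> X" "f ` A \<subseteq> A" "x \<in> X"
  shows "(quotient_fun (collapse_rel X A) f ^^ n) (collapse_rel X A `` {x}) =
         collapse_rel X A `` {(f ^^ n) x}"
  by (induction n)
    (simp_all add: quotient_fun_class[OF assms(1,2)] funpow_in_carrier[OF assms(1,3)])

lemma class_periodic_if_periodic: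
  assumes "f \<in> X \<rightarrow> X" "f ` A \<subseteq> A" "p \<in> periodic_points X f"
  shows "collapse_rel X A `` {p} \<in>
         periodic_points (X // collapse_rel X A) (quotient_fun (collapse_rel X A) f)"
proof -
  obtain n where p: "p \<in> X" "n > 0" "(f ^^ n) p = p"
    using assms(3) by (auto simp: periodic_points_def)
  then have "(quotient_fun (collapse_rel X A) f ^^ n) (collapse_rel X A `` {p}) =
      collapse_rel X A `` {p}"
    by (simp add: quotient_fun_funpow_class[OF assms(1,2)])
  with p show ?thesis
    by (auto simp: periodic_points_def intro: quotientI)
qed

text \<open>Off \<open>A\<close> nothing is identified, so a return of the class of \<open>p\<close> is a return of \<open>p\<close>.
  A point of \<open>A\<close> need not be periodic even though its class is fixed.\<close>

lemma class_periodic_iff: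
  assumes "f \<in> X \<rightarrow> X" "f ` A \<subseteq> A" "p \<in> X - A"
  shows "collapse_rel X A `` {p} \<in>
           periodic_points (X // collapse_rel X A) (quotient_fun (collapse_rel X A) f)
         \<longleftrightarrow> p \<in> periodic_points X f"
proof
  assume "collapse_rel X A `` {p} \<in>
    periodic_points (X // collapse_rel X A) (quotient_fun (collapse_rel X A) f)"
  then obtain n where "n > 0" and
    "collapse_rel X A `` {(f ^^ n) p} = collapse_rel X A `` {p}"
    using assms by (auto simp: periodic_points_def quotient_fun_funpow_class)
  then have "(f ^^ n) p = p"
    using assms(3) funpow_in_carrier[OF assms(1)] by (simp add: class_eq_iff)
  with \<open>n > 0\<close> assms(3) show "p \<in> periodic_points X f"
    by (auto simp: periodic_points_def)
qed (rule class_periodic_if_periodic[OF assms(1,2)])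

text \<open>A projection to a quotient is in general not an open map. Here no point of \<open>W\<close> is identified
  with any other point, so \<open>W\<close> is saturated and its image is open.\<close>

lemma openin_classes_off_collapsed:
  assumes "openin T W" "W \<inter> A = {}"
  shows "openin (quotient_topology T (collapse_rel (topspace T) A))
           ((\<lambda>x. collapse_rel (topspace T) A `` {x}) ` W)"
proof -
  let ?r = "collapse_rel (topspace T) A"
  have W: "W \<subseteq> topspace T"
    using assms(1) by (rule openin_subset)
  have "{x \<in> topspace T. ?r `` {x} \<in> (\<lambda>x. ?r `` {x}) ` W} = W"
    using W assms(2) class_eq_iff[of _ "topspace T" _ A] by blast
  then show ?thesis
    using W assms(1) by (auto simp: openin_quotient_topology intro: quotientI)
qed

lemma nonempty_open_minus_nowhere_dense:
  assumes "nowhere_dense_in T A" "openin T U" "U \<noteq> {}"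
  shows "U - A \<noteq> {}"
proof
  assume "U - A = {}"
  moreover have "A \<subseteq> T closure_of A"
    using assms(1) by (simp add: nowhere_dense_in_def closure_of_subset)
  ultimately have "U \<subseteq> T interior_of (T closure_of A)"
    using assms(2) by (intro interior_of_maximal) auto
  with assms show False
    by (simp add: nowhere_dense_in_def)
qed

lemma dense_periodic_points_collapse_iff:
  assumes f: "f \<in> topspace T \<rightarrow> topspace T"
    and A: "closedin T A" "nowhere_dense_in T A" "f ` A \<subseteq> A"
  shows "dense_in T (periodic_points (topspace T) f) \<longleftrightarrow>
         dense_in (quotient_topology T (collapse_rel (topspace T) A))
           (periodic_points (topspace T // collapse_rel (topspace T) A)
             (quotient_fun (collapse_rel (topspace T) A) f))"
    (is "dense_in T ?P \<longleftrightarrow> dense_in ?Q ?PQ")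
proof
  let ?r = "collapse_rel (topspace T) A"
  assume dense: "dense_in T ?P"
  have "?PQ \<inter> V \<noteq> {}" if V: "openin ?Q V" "V \<noteq> {}" for V
  proof -
    let ?U = "{x \<in> topspace T. ?r `` {x} \<in> V}"
    have "V \<subseteq> topspace T // ?r" "openin T ?U"
      using V(1) by (simp_all add: openin_quotient_topology)
    moreover from this V(2) have "?U \<noteq> {}"
      by (auto simp: quotient_def)
    ultimately have "?P \<inter> ?U \<noteq> {}"
      using dense unfolding dense_in_iff_meets_open by blast
    then obtain p where "p \<in> ?P" "?r `` {p} \<in> V"
      by blast
    then show ?thesis
      using class_periodic_if_periodic[OF f A(3)] by blast
  qed
  moreover have "?PQ \<subseteq> topspace ?Q"
    by (auto simp: topspace_quotient_topology periodic_points_def)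
  ultimately show "dense_in ?Q ?PQ"
    unfolding dense_in_iff_meets_open by blast
next
  let ?r = "collapse_rel (topspace T) A"
  assume dense: "dense_in ?Q ?PQ"
  have "?P \<inter> U \<noteq> {}" if U: "openin T U" "U \<noteq> {}" for U
  proof -
    have "openin T (U - A)" "U - A \<noteq> {}"
      by (rule openin_diff[OF U(1) A(1)], rule nonempty_open_minus_nowhere_dense[OF A(2) U])
    then have "openin ?Q ((\<lambda>x. ?r `` {x}) ` (U - A))" "(\<lambda>x. ?r `` {x}) ` (U - A) \<noteq> {}"
      by (blast intro: openin_classes_off_collapsed)+
    then have "?PQ \<inter> (\<lambda>x. ?r `` {x}) ` (U - A) \<noteq> {}"
      using dense unfolding dense_in_iff_meets_open by blast
    then obtain p where p: "p \<in> U - A" "?r `` {p} \<in> ?PQ"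
      by blast
    moreover have "p \<in> topspace T - A"
      using p(1) openin_subset[OF U(1)] by blast
    ultimately have "p \<in> ?P"
      using class_periodic_iff[OF f A(3)] by blast
    with p(1) show ?thesis by blast
  qed
  moreover have "?P \<subseteq> topspace T"
    by (auto simp: periodic_points_def)
  ultimately show "dense_in T ?P"
    unfolding dense_in_iff_meets_open by blast
qed

theorem theorem3p16:
  fixes X :: "'a set" and d :: "'a \<Rightarrow> 'a \<Rightarrow> real" and f :: "'a \<Rightarrow> 'a" and A :: "'a set"
  assumes "Metric_space X d"
    and "compact_space (Metric_space.mtopology X d)"
    and "continuous_map (Metric_space.mtopology X d) (Metric_space.mtopology X d) f"
    and "closedin (Metric_space.mtopology X d) A"
    and "nowhere_dense_in (Metric_space.mtopology X d) A"
    and "f ` A \<subseteq> A"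
    and "f ` (X - A) \<subseteq> X - A"
  shows "dense_in (Metric_space.mtopology X d) (periodic_points X f) \<longleftrightarrow>
         dense_in (quotient_topology (Metric_space.mtopology X d) (collapse_rel X A))
           (periodic_points (X // collapse_rel X A) (quotient_fun (collapse_rel X A) f))"
proof -
  let ?T = "Metric_space.mtopology X d"
  have X: "topspace ?T = X"
    using assms(1) by (rule Metric_space.topspace_mtopology)
  have "f \<in> topspace ?T \<rightarrow> topspace ?T"
    using assms(3) by (simp add: continuous_map_def)
  from dense_periodic_points_collapse_iff[OF this assms(4-6)] show ?thesis
    by (simp only: X)
qed

end
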